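(* Let $n\ge 2$, $0<\theta<\pi/2$, $\delta=(\pi-\theta)/2$, and let $C$ be a $\theta$-code contained in the hemisphere $S_+=\{x\in S^{n-1}:\langle x,e_n\rangle\ge 0\}$. Then $$\bigl|\{x\in C:\delta<\operatorname{dist}(x,e_n)\le \pi/2\}\bigr|+2\,\bigl|\{x\in C:\operatorname{dist}(x,e_n)\le\delta\}\bigr|\le A(n,\theta).$$
   Context: $S^{n-1}$ is the unit sphere in $\mathbb R^n$, $e_n=(0,\dots,0,1)$, $\operatorname{dist}$ is angular distance on the sphere. A finite set $C\subset S^{n-1}$ is a $\theta$-code if $\operatorname{dist}(x,y)\ge\theta$ for all distinct $x,y\in C$. $A(n,\theta)$ is the maximum size of a $\theta$-code in $S^{n-1}$. *)

theory Defs
  imports "HOL-Analysis.Analysis"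
begin

text \<open>
  \<open>\<real>\<^sup>n\<close> is \<open>real ^ 'n\<close> with \<open>n = CARD('n)\<close>. The index type is linearly ordered where
  the last coordinate has to be singled out.
\<close>

definition e_last :: "real ^ 'n::{finite,linorder}" where
  "e_last = axis (Max UNIV) 1"

text \<open>Only meaningful for unit vectors, where it is the length of a shortest great-circle arc.\<close>

definition sphere_dist :: "real ^ 'n \<Rightarrow> real ^ 'n \<Rightarrow> real" where
  "sphere_dist x y = arccos (x \<bullet> y)"

definition spherical_code :: "real \<Rightarrow> (real ^ 'n) set \<Rightarrow> bool" where
  "spherical_code \<theta> C \<longleftrightarrow>
     finite C \<and> C \<subseteq> sphere 0 1 \<and> (\<forall>x\<in>C. \<forall>y\<in>C. x \<noteq> y \<longrightarrow> sphere_dist x y \<ge> \<theta>)"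

text \<open>
  \<open>max_code_size TYPE('n) \<theta>\<close> is \<open>A(n, \<theta>)\<close> for \<open>n = CARD('n)\<close>. The set below is finite and
  nonempty for \<open>0 < \<theta> \<le> \<pi>\<close> by the lemma that follows, so \<^const>\<open>Max\<close> is a genuine maximum.
\<close>

definition max_code_size :: "'n::finite itself \<Rightarrow> real \<Rightarrow> nat" where
  "max_code_size (_ :: 'n::finite itself) \<theta> = Max {card C |C :: (real ^ 'n) set. spherical_code \<theta> C}"

lemma code_sizes_finite_nonempty:
  assumes "0 < \<theta>" "\<theta> \<le> pi"
  shows "finite {card C |C :: (real ^ 'n) set. spherical_code \<theta> C}"
    and "{card C |C :: (real ^ 'n) set. spherical_code \<theta> C} \<noteq> {}"
proof -
  have "spherical_code \<theta> ({} :: (real ^ 'n) set)"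
    by (simp add: spherical_code_def)
  then show "{card C |C :: (real ^ 'n) set. spherical_code \<theta> C} \<noteq> {}"
    by blast
  define d where "d = sqrt (2 - 2 * cos \<theta>)"
  have "cos \<theta> < cos 0"
    using assms by (intro cos_monotone_0_pi) auto
  then have d: "d > 0" "d\<^sup>2 = 2 - 2 * cos \<theta>"
    by (auto simp: d_def)
  have sep: "d \<le> dist x y"
    if "x \<in> sphere 0 1" "y \<in> sphere 0 1" "\<theta> \<le> sphere_dist x y" for x y :: "real ^ 'n"
  proof -
    have n: "norm x = 1" "norm y = 1"
      using that by auto
    then have b: "\<bar>x \<bullet> y\<bar> \<le> 1"
      using Cauchy_Schwarz_ineq2[of x y] by simp
    have "cos (sphere_dist x y) \<le> cos \<theta>"
      using that(3) assms b arccos_ubound[of "x \<bullet> y"]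
      by (intro cos_monotone_0_pi_le) (auto simp: sphere_dist_def abs_le_iff)
    then have "x \<bullet> y \<le> cos \<theta>"
      using b by (simp add: sphere_dist_def cos_arccos_abs)
    moreover have "(dist x y)\<^sup>2 = 2 - 2 * (x \<bullet> y)"
      using n dot_norm_neg[of x y] by (simp add: dist_norm)
    ultimately have "d\<^sup>2 \<le> (dist x y)\<^sup>2"
      using d by simp
    then show ?thesis
      by (rule power2_le_imp_le) simp
  qed
  obtain K :: "(real ^ 'n) set" where K: "finite K" "sphere 0 1 \<subseteq> (\<Union>k\<in>K. ball k (d / 2))"
    using compact_sphere[of "0 :: real ^ 'n" 1] d(1) unfolding compact_eq_totally_bounded
    using half_gt_zero by blast
  have "card C \<le> card K" if C: "spherical_code \<theta> C" for C :: "(real ^ 'n) set"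
  proof -
    have "\<forall>x\<in>C. \<exists>k\<in>K. x \<in> ball k (d / 2)"
      using C K(2) unfolding spherical_code_def by blast
    then obtain f where f: "\<And>x. x \<in> C \<Longrightarrow> f x \<in> K \<and> x \<in> ball (f x) (d / 2)"
      by metis
    have "inj_on f C"
    proof (rule inj_onI, rule ccontr)
      fix x y
      assume xy: "x \<in> C" "y \<in> C" "f x = f y" "x \<noteq> y"
      then have "d \<le> dist x y"
        using C by (intro sep) (auto simp: spherical_code_def)
      moreover have "dist x y < d"
        using f[OF xy(1)] f[OF xy(2)] xy(3) dist_triangle_half_r[of "f x" x d y] by simp
      ultimately show False
        by simp
    qed
    then show ?thesis
      using f K(1) by (intro card_inj_on_le[of f]) auto
  qed
  then show "finite {card C |C :: (real ^ 'n) set. spherical_code \<theta> C}"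
    by (intro finite_subset[OF _ finite_atMost[of "card K"]]) auto
qed

end

theory Submission
  imports Defs
begin

text \<open>
  Let \<open>e\<close> be the north pole and \<open>C'\<close> the set of codewords within distance \<open>\<delta>\<close> of \<open>e\<close>. Reflecting
  \<open>C'\<close> in the equator gives \<open>|C'|\<close> further points, all in the open southern hemisphere and hence
  outside \<open>C\<close>. The left-hand side is therefore the size of the union of \<open>C\<close> and the mirror image
  of \<open>C'\<close>, and it remains to see that this union is again a \<open>\<theta>\<close>-code.

  Distances between mirror images are those of the originals. If \<open>x \<in> C'\<close> has mirror image \<open>x'\<close>
  and \<open>y \<in> C\<close>, then \<open>x' \<bullet> y = x \<bullet> y - 2 (x \<bullet> e) (y \<bullet> e)\<close>. For \<open>y \<noteq> x\<close> the subtracted term is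
  nonnegative, so \<open>y\<close> is at least as far from \<open>x'\<close> as from \<open>x\<close>. For \<open>y = x\<close> the point lies in the
  cap of radius \<open>\<delta>\<close> and its image in the opposite cap; these two caps are
  \<open>\<pi> - 2 \<delta> = \<theta>\<close> apart, which is where the value of \<open>\<delta>\<close> comes from.
\<close>

lemma norm_e_last [simp]: "norm (e_last :: real ^ 'n::{finite,linorder}) = 1"
  by (simp add: e_last_def)

text \<open>Trading angles for inner products makes all separation conditions below polynomial.\<close>

lemma sphere_dist_le_iff:
  assumes "norm x = 1" "norm y = 1" "0 \<le> t" "t \<le> pi"
  shows "sphere_dist x y \<le> t \<longleftrightarrow> cos t \<le> x \<bullet> y"
    and "t \<le> sphere_dist x y \<longleftrightarrow> x \<bullet> y \<le> cos t"
proof -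
  have b: "\<bar>x \<bullet> y\<bar> \<le> 1"
    using Cauchy_Schwarz_ineq2[of x y] assms by simp
  then have r: "0 \<le> sphere_dist x y" "sphere_dist x y \<le> pi" "cos (sphere_dist x y) = x \<bullet> y"
    by (auto simp: sphere_dist_def arccos_lbound arccos_ubound cos_arccos_abs abs_le_iff)
  show "sphere_dist x y \<le> t \<longleftrightarrow> cos t \<le> x \<bullet> y"
    using cos_mono_le_eq[of "t" "sphere_dist x y"] r assms by simp
  show "t \<le> sphere_dist x y \<longleftrightarrow> x \<bullet> y \<le> cos t"
    using cos_mono_le_eq[of "sphere_dist x y" t] r assms by simp
qed

definition reflect :: "'a::real_inner \<Rightarrow> 'a \<Rightarrow> 'a" where
  "reflect e x = x - (2 * (x \<bullet> e)) *\<^sub>R e"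

lemma inner_reflect_left: "reflect e x \<bullet> y = x \<bullet> y - 2 * (x \<bullet> e) * (y \<bullet> e)"
  by (simp add: reflect_def inner_diff_left inner_commute[of e y])

lemma inner_reflect_reflect:
  assumes "norm e = 1"
  shows "reflect e x \<bullet> reflect e y = x \<bullet> y"
proof -
  have "e \<bullet> e = 1"
    using assms by (simp add: dot_square_norm)
  then show ?thesis
    by (simp add: reflect_def inner_diff_left inner_diff_right inner_commute)
qed

lemma inner_reflect_pole:
  assumes "norm e = 1"
  shows "reflect e x \<bullet> e = - (x \<bullet> e)"
  using assms by (simp add: inner_reflect_left dot_square_norm)

lemma norm_reflect:
  assumes "norm e = 1"
  shows "norm (reflect e x) = norm x"
  using inner_reflect_reflect[OF assms, of x x] by (simp add: norm_eq_sqrt_inner)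

lemma inj_reflect:
  assumes "norm e = 1"
  shows "inj (reflect e)"
proof (rule injI)
  fix x y
  assume "reflect e x = reflect e y"
  moreover from this have "x \<bullet> e = y \<bullet> e"
    using inner_reflect_pole[OF assms] by (metis neg_equal_iff_equal)
  ultimately show "x = y"
    by (simp add: reflect_def)
qed

text \<open>
  The height bound \<open>1 - 2 c\<^sup>2 \<le> cos \<theta>\<close> says that an angle whose cosine is \<open>c\<close> is at most
  \<open>(\<pi> - \<theta>) / 2\<close>, so that a point at height at least \<open>c\<close> is moved through an angle of at
  least \<open>\<theta>\<close>.
\<close>

lemma spherical_code_Un_reflect:
  fixes C D :: "(real ^ 'n) set"
  assumes code: "spherical_code \<theta> C" and \<theta>: "0 \<le> \<theta>" "\<theta> \<le> pi"
    and e: "norm e = 1"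
    and north: "\<And>x. x \<in> C \<Longrightarrow> 0 \<le> x \<bullet> e"
    and D: "D \<subseteq> C" "\<And>x. x \<in> D \<Longrightarrow> c \<le> x \<bullet> e"
    and c: "0 \<le> c" "1 - 2 * c\<^sup>2 \<le> cos \<theta>"
  shows "spherical_code \<theta> (C \<union> reflect e ` D)"
proof -
  have unit: "norm x = 1" if "x \<in> C" for x
    using code that by (auto simp: spherical_code_def)
  have sep: "x \<bullet> y \<le> cos \<theta>" if "x \<in> C" "y \<in> C" "x \<noteq> y" for x y
    using code that sphere_dist_le_iff(2)[OF unit unit \<theta>] by (auto simp: spherical_code_def)
  have cross: "reflect e x \<bullet> y \<le> cos \<theta>" if "x \<in> D" "y \<in> C" for x y
  proof (cases "x = y")
    case True
    have "c\<^sup>2 \<le> (x \<bullet> e)\<^sup>2"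
      using D that c by (intro power_mono) auto
    then show ?thesis
      using True c unit[OF that(2)] by (simp add: inner_reflect_left dot_square_norm power2_eq_square)
  next
    case False
    have "0 \<le> (x \<bullet> e) * (y \<bullet> e)"
      using north that D by (intro mult_nonneg_nonneg) auto
    then show ?thesis
      using sep[of x y] False that D by (auto simp: inner_reflect_left)
  qed
  have mirror: "reflect e x \<bullet> reflect e y \<le> cos \<theta>" if "x \<in> D" "y \<in> D" "x \<noteq> y" for x y
    using sep[of x y] that D(1) by (auto simp: inner_reflect_reflect[OF e])
  have cross': "y \<bullet> reflect e x \<le> cos \<theta>" if "x \<in> D" "y \<in> C" for x y
    using cross[OF that] by (simp add: inner_commute)
  have "x \<bullet> y \<le> cos \<theta>"
    if "x \<in> C \<union> reflect e ` D" "y \<in> C \<union> reflect e ` D" "x \<noteq> y" for x y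
    using that by (blast intro: sep cross cross' mirror)
  moreover have "norm x = 1" if "x \<in> C \<union> reflect e ` D" for x
    using that unit D(1) norm_reflect[OF e] by auto
  moreover have "finite (C \<union> reflect e ` D)"
    using code D(1) finite_subset by (auto simp: spherical_code_def)
  ultimately show ?thesis
    by (auto simp: spherical_code_def sphere_dist_le_iff(2)[OF _ _ \<theta>])
qed

lemma card_le_max_code_size:
  fixes C :: "(real ^ 'n) set"
  assumes "spherical_code \<theta> C" "0 < \<theta>" "\<theta> \<le> pi"
  shows "card C \<le> max_code_size TYPE('n) \<theta>"
  unfolding max_code_size_def
  using assms by (intro Max_ge code_sizes_finite_nonempty) auto

theorem theorem9:
  fixes C :: "(real ^ 'n::{finite,linorder}) set" and \<theta> \<delta> :: real
  assumes "CARD('n) \<ge> 2"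
    and "0 < \<theta>" and "\<theta> < pi / 2"
    and "\<delta> = (pi - \<theta>) / 2"
    and "spherical_code \<theta> C"
    and "C \<subseteq> {x \<in> sphere 0 1. x \<bullet> e_last \<ge> 0}"
  shows "card {x \<in> C. \<delta> < sphere_dist x e_last \<and> sphere_dist x e_last \<le> pi / 2}
           + 2 * card {x \<in> C. sphere_dist x e_last \<le> \<delta>}
         \<le> max_code_size TYPE('n) \<theta>"
proof -
  let ?e = "e_last :: (real, 'n) vec"
  define band where "band = {x \<in> C. \<delta> < sphere_dist x ?e \<and> sphere_dist x ?e \<le> pi / 2}"
  define cap where "cap = {x \<in> C. sphere_dist x ?e \<le> \<delta>}"
  have \<delta>: "0 \<le> \<delta>" "\<delta> < pi / 2" "\<delta> \<le> pi"
    using assms(2-4) by auto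
  have C: "norm x = 1" "0 \<le> x \<bullet> ?e" if "x \<in> C" for x
    using assms(6) that by auto
  have fin: "finite C"
    using assms(5) by (simp add: spherical_code_def)
  have pos: "0 < cos \<delta>"
    using \<delta> by (intro cos_gt_zero_pi) auto
  have height: "cos \<delta> \<le> x \<bullet> ?e" if "x \<in> cap" for x
    using that C(1)[of x] \<delta> sphere_dist_le_iff(1)[of x ?e \<delta>] by (simp add: cap_def)
  have "1 - 2 * (cos \<delta>)\<^sup>2 = - cos (2 * \<delta>)"
    by (simp add: cos_double_cos)
  also have "2 * \<delta> = pi - \<theta>"
    using assms(4) by simp
  finally have separation: "1 - 2 * (cos \<delta>)\<^sup>2 \<le> cos \<theta>"
    by simp
  have code: "spherical_code \<theta> (C \<union> reflect ?e ` cap)"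
  proof (rule spherical_code_Un_reflect[OF assms(5) _ _ _ C(2) _ height _ separation])
    show "cap \<subseteq> C"
      by (auto simp: cap_def)
  qed (use assms(2,3) pos in simp_all)
  have south: "reflect ?e x \<bullet> ?e < 0" if "x \<in> cap" for x
    using height[OF that] pos by (simp add: inner_reflect_pole)
  have disjoint: "C \<inter> reflect ?e ` cap = {}"
  proof -
    have "reflect ?e x \<notin> C" if "x \<in> cap" for x
      using south[OF that] C(2)[of "reflect ?e x"] by auto
    then show ?thesis
      by blast
  qed
  have "sphere_dist x ?e \<le> pi / 2" if "x \<in> C" for x
    using C[OF that] sphere_dist_le_iff(1)[of x ?e "pi / 2"] by simp
  then have "C = band \<union> cap"
    by (auto simp: band_def cap_def)
  moreover have "band \<inter> cap = {}"
    by (auto simp: band_def cap_def)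
  moreover have "finite band" "finite cap"
    using fin by (auto simp: band_def cap_def)
  ultimately have "card C = card band + card cap"
    by (simp add: card_Un_disjoint)
  moreover have "card (reflect ?e ` cap) = card cap"
    by (rule card_image[OF inj_on_subset[OF inj_reflect]]) simp_all
  moreover have "card (C \<union> reflect ?e ` cap) = card C + card (reflect ?e ` cap)"
    using fin \<open>finite cap\<close> disjoint by (intro card_Un_disjoint) auto
  ultimately have "card band + 2 * card cap = card (C \<union> reflect ?e ` cap)"
    by simp
  also have "\<dots> \<le> max_code_size TYPE('n) \<theta>"
    using code assms(2,3) by (intro card_le_max_code_size) auto
  finally show ?thesis
    by (simp add: band_def cap_def)
qed

end
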